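(* For any algorithm for the (exact) dynamic maximum weighted independent set of intervals problem, where the intervals are contained in the space $[0,N]$ and have size at least $1$, the amortized update and query time is $\Omega(\log N/\log\log N)$.
   Context: The dynamic maximum weighted independent set of intervals problem: maintain a set of weighted intervals contained in $[0,N]$, each of length (size) at least $1$, under updates, each of which inserts or deletes one interval. An independent set is a set of pairwise disjoint intervals. A query returns the total weight of a maximum-weight independent set among the current intervals (only the weight, not the set itself); "exact" means that this maximum weight is returned exactly, not approximately. The lower bound is a cell-probe lower bound. *)

theory Defs
  imports Complex_Main "HOL-Library.Landau_Symbols"
begin

section \<open>Weighted intervals\<close>

text \<open>A triple \<open>(l, r, v)\<close> is the closed interval \<open>[l, r]\<close> with weight \<open>v\<close>. Intervals with
  the same end points but different weights are different.\<close>

type_synonym wival = "real \<times> real \<times> real"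

definition ival :: "wival \<Rightarrow> real set" where
  "ival x = (case x of (l, r, v) \<Rightarrow> {l..r})"

definition weight :: "wival \<Rightarrow> real" where
  "weight x = (case x of (l, r, v) \<Rightarrow> v)"

definition wivals :: "nat \<Rightarrow> wival set" where
  "wivals N = {(l, r, v). 0 \<le> l \<and> r \<le> real N \<and> r - l \<ge> 1 \<and> v > 0}"

text \<open>Members of \<open>wivals N\<close> with integral data of \<open>O(log N)\<close> bits. Cells of \<open>O(log N)\<close> bits
  cannot represent arbitrary real end points and weights, so realistic data structures only
  support a subset of \<open>wivals N\<close>.\<close>

definition grid_wivals :: "nat \<Rightarrow> wival set" where
  "grid_wivals N =
     {(real l, real r, real v) | l r v. l < r \<and> r \<le> N \<and> 1 \<le> v \<and> v \<le> N}"

definition independent :: "wival set \<Rightarrow> bool" where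
  "independent J \<longleftrightarrow> pairwise (\<lambda>x y. disjnt (ival x) (ival y)) J"

definition mwis :: "wival set \<Rightarrow> real" where
  "mwis S = Max {(\<Sum>x\<in>J. weight x) | J. J \<subseteq> S \<and> independent J}"


section \<open>Cell-probe programs\<close>

text \<open>The memory consists of cells addressed by natural numbers; the number of cells is not
  limited. A program is an adaptive sequence of probes; computation between probes is free.\<close>

type_synonym memory = "nat \<Rightarrow> nat"

datatype 'r prog =
    Return 'r
  | Read nat "nat \<Rightarrow> 'r prog"
  | Write nat nat "'r prog"

text \<open>With cells of \<open>w\<close> bits, a program may only write numbers below \<open>2 ^ w\<close>; its behaviour
  on larger read values is irrelevant.\<close>

primrec fits_word :: "nat \<Rightarrow> 'r prog \<Rightarrow> bool" where
  "fits_word w (Return r) \<longleftrightarrow> True"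
| "fits_word w (Read a k) \<longleftrightarrow> (\<forall>v < 2 ^ w. fits_word w (k v))"
| "fits_word w (Write a v p) \<longleftrightarrow> v < 2 ^ w \<and> fits_word w p"

primrec result :: "'r prog \<Rightarrow> memory \<Rightarrow> 'r" where
  "result (Return r) m = r"
| "result (Read a k) m = result (k (m a)) m"
| "result (Write a v p) m = result p (m(a := v))"

primrec final_memory :: "'r prog \<Rightarrow> memory \<Rightarrow> memory" where
  "final_memory (Return r) m = m"
| "final_memory (Read a k) m = final_memory (k (m a)) m"
| "final_memory (Write a v p) m = final_memory p (m(a := v))"

primrec probes :: "'r prog \<Rightarrow> memory \<Rightarrow> nat" where
  "probes (Return r) m = 0"
| "probes (Read a k) m = Suc (probes (k (m a)) m)"
| "probes (Write a v p) m = Suc (probes p (m(a := v)))"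


section \<open>Dynamic maximum weighted independent set of intervals\<close>

datatype operation = Insert wival | Delete wival | Query

fun is_query :: "operation \<Rightarrow> bool" where
  "is_query Query \<longleftrightarrow> True"
| "is_query _ \<longleftrightarrow> False"

text \<open>\<open>legal U S ops\<close>: starting from the current set \<open>S\<close>, the sequence only inserts intervals
  of \<open>U\<close> that are absent and only deletes intervals that are present.\<close>

fun legal :: "wival set \<Rightarrow> wival set \<Rightarrow> operation list \<Rightarrow> bool" where
  "legal U S [] \<longleftrightarrow> True"
| "legal U S (Insert x # ops) \<longleftrightarrow> x \<in> U \<and> x \<notin> S \<and> legal U (insert x S) ops"
| "legal U S (Delete x # ops) \<longleftrightarrow> x \<in> S \<and> legal U (S - {x}) ops"
| "legal U S (Query # ops) \<longleftrightarrow> legal U S ops"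

fun current_set :: "wival set \<Rightarrow> operation list \<Rightarrow> wival set" where
  "current_set S [] = S"
| "current_set S (Insert x # ops) = current_set (insert x S) ops"
| "current_set S (Delete x # ops) = current_set (S - {x}) ops"
| "current_set S (Query # ops) = current_set S ops"

text \<open>Nothing but the memory is kept between operations. The initial memory is arbitrary, that
  is, preprocessing is free. Queries may modify the memory.\<close>

record cell_probe_ds =
  init_memory :: memory
  insert_prog :: "wival \<Rightarrow> unit prog"
  delete_prog :: "wival \<Rightarrow> unit prog"
  query_prog :: "real prog"

definition word_size :: "nat \<Rightarrow> cell_probe_ds \<Rightarrow> bool" where
  "word_size w D \<longleftrightarrow>
     (\<forall>a. init_memory D a < 2 ^ w) \<and>
     (\<forall>x. fits_word w (insert_prog D x)) \<and>
     (\<forall>x. fits_word w (delete_prog D x)) \<and>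
     fits_word w (query_prog D)"

fun op_memory :: "cell_probe_ds \<Rightarrow> operation \<Rightarrow> memory \<Rightarrow> memory" where
  "op_memory D (Insert x) m = final_memory (insert_prog D x) m"
| "op_memory D (Delete x) m = final_memory (delete_prog D x) m"
| "op_memory D Query m = final_memory (query_prog D) m"

fun op_probes :: "cell_probe_ds \<Rightarrow> operation \<Rightarrow> memory \<Rightarrow> nat" where
  "op_probes D (Insert x) m = probes (insert_prog D x) m"
| "op_probes D (Delete x) m = probes (delete_prog D x) m"
| "op_probes D Query m = probes (query_prog D) m"

definition memory_after :: "cell_probe_ds \<Rightarrow> operation list \<Rightarrow> memory" where
  "memory_after D ops = fold (op_memory D) ops (init_memory D)"

fun probes_from :: "cell_probe_ds \<Rightarrow> memory \<Rightarrow> operation list \<Rightarrow> nat" where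
  "probes_from D m [] = 0"
| "probes_from D m (c # ops) = op_probes D c m + probes_from D (op_memory D c m) ops"

definition total_probes :: "cell_probe_ds \<Rightarrow> operation list \<Rightarrow> nat" where
  "total_probes D ops = probes_from D (init_memory D) ops"

text \<open>\<open>D\<close> maintains the exact maximum weight for all inputs drawn from \<open>U\<close>. Legality is closed
  under appending a query, so this covers every query within a legal sequence.\<close>

definition solves_dynamic_mwis :: "wival set \<Rightarrow> cell_probe_ds \<Rightarrow> bool" where
  "solves_dynamic_mwis U D \<longleftrightarrow>
     (\<forall>ops. legal U {} ops \<longrightarrow>
        result (query_prog D) (memory_after D ops) = mwis (current_set {} ops))"

definition amortized_time :: "wival set \<Rightarrow> cell_probe_ds \<Rightarrow> real \<Rightarrow> real \<Rightarrow> bool" where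
  "amortized_time U D tu tq \<longleftrightarrow>
     (\<forall>ops. legal U {} ops \<longrightarrow>
        real (total_probes D ops) \<le>
          tu * real (length (filter (\<lambda>c. \<not> is_query c) ops)) +
          tq * real (length (filter is_query ops)))"

end

theory Submission
  imports Defs
begin

text \<open>The argument is the information transfer method of Patrascu and Demaine, applied to prefix
  sums, and it even gives \<open>\<Omega>(log N)\<close>. Disjoint unit intervals with weights of \<open>k = \<Theta>(log N)\<close> bits
  are inserted in bit-reversed order. After each insertion a heavy interval that covers everything
  to the right is inserted and removed again, so that a query in between reveals a prefix sum. In
  a time segment of \<open>2 * 2 ^ j\<close> insertions the positions of the two halves interleave; hence, all
  else being fixed, the answers in the second half determine all weights of the first half. The
  second half learns about the first one only from cells written there. Its probes
  form a decision tree: charging one bit per probe, and \<open>w\<close> further bits for the first read of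
  such a cell, satisfies Kraft's inequality (addresses cost nothing, so their size is irrelevant).
  On average the charge is therefore at least \<open>k * 2 ^ j\<close>. Every read is charged \<open>w\<close> bits at most
  once in the binary tree of time segments, and one bit at each of the \<open>k\<close> levels.\<close>

section \<open>Programs\<close>

text \<open>Sequencing turns a whole time segment into one program, hence one decision tree for
  Kraft's inequality.\<close>

primrec bind_prog :: "'a prog \<Rightarrow> ('a \<Rightarrow> 'b prog) \<Rightarrow> 'b prog" where
  "bind_prog (Return r) f = f r"
| "bind_prog (Read a k) f = Read a (\<lambda>v. bind_prog (k v) f)"
| "bind_prog (Write a v p) f = Write a v (bind_prog p f)"

text \<open>Only cells that are read before they are written count: the initial contents of these cells
  determine the run.\<close>

primrec fresh_reads :: "'r prog \<Rightarrow> memory \<Rightarrow> nat set" where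
  "fresh_reads (Return r) m = {}"
| "fresh_reads (Read a k) m = insert a (fresh_reads (k (m a)) m)"
| "fresh_reads (Write a v p) m = fresh_reads p (m(a := v)) - {a}"

primrec written :: "'r prog \<Rightarrow> memory \<Rightarrow> nat set" where
  "written (Return r) m = {}"
| "written (Read a k) m = written (k (m a)) m"
| "written (Write a v p) m = insert a (written p (m(a := v)))"

lemma result_bind [simp]:
  "result (bind_prog p f) m = result (f (result p m)) (final_memory p m)"
  by (induction p arbitrary: m) auto

lemma final_memory_bind [simp]:
  "final_memory (bind_prog p f) m = final_memory (f (result p m)) (final_memory p m)"
  by (induction p arbitrary: m) auto

lemma probes_bind [simp]:
  "probes (bind_prog p f) m = probes p m + probes (f (result p m)) (final_memory p m)"
  by (induction p arbitrary: m) auto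

lemma written_bind [simp]:
  "written (bind_prog p f) m = written p m \<union> written (f (result p m)) (final_memory p m)"
  by (induction p arbitrary: m) auto

lemma fresh_reads_bind [simp]:
  "fresh_reads (bind_prog p f) m =
     fresh_reads p m \<union> (fresh_reads (f (result p m)) (final_memory p m) - written p m)"
  by (induction p arbitrary: m) auto

lemma fits_word_bind:
  "fits_word w p \<Longrightarrow> (\<And>r. fits_word w (f r)) \<Longrightarrow> fits_word w (bind_prog p f)"
  by (induction p) auto

lemma finite_fresh_reads [simp]: "finite (fresh_reads p m)"
  by (induction p arbitrary: m) auto

lemma card_fresh_reads_le: "card (fresh_reads p m) \<le> probes p m"
proof (induction p arbitrary: m)
  case (Read a k)
  have "card (insert a (fresh_reads (k (m a)) m)) \<le> Suc (card (fresh_reads (k (m a)) m))"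
    by (simp add: card_insert_if)
  also have "\<dots> \<le> Suc (probes (k (m a)) m)" using Read by simp
  finally show ?case by simp
next
  case (Write a v p)
  have "card (fresh_reads p (m(a := v)) - {a}) \<le> card (fresh_reads p (m(a := v)))"
    by (intro card_mono) auto
  also have "\<dots> \<le> probes p (m(a := v))" using Write by simp
  finally show ?case by simp
qed simp

lemma final_memory_not_written: "a \<notin> written p m \<Longrightarrow> final_memory p m a = m a"
  by (induction p arbitrary: m) auto

lemma final_memory_less:
  "fits_word w p \<Longrightarrow> (\<And>a. m a < 2 ^ w) \<Longrightarrow> final_memory p m b < 2 ^ w"
  by (induction p arbitrary: m) auto

section \<open>Kraft's inequality for programs\<close>

text \<open>Here \<open>W x\<close> are the cells in which the unknown memory \<open>mem x\<close> may differ from the known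
  memory \<open>m0\<close>. A read outside \<open>W x\<close> has one possible outcome, a read in \<open>W x\<close> has \<open>2 ^ w\<close> of them
  and makes the cell known. The bit paid for each probe separates the two cases.\<close>

lemma kraft_prog:
  fixes mem :: "'x \<Rightarrow> memory"
  assumes "finite V" and "inj_on (\<lambda>x. result q (mem x)) V"
    and "\<And>x a. x \<in> V \<Longrightarrow> a \<notin> W x \<Longrightarrow> mem x a = m0 a"
    and "\<And>x a. x \<in> V \<Longrightarrow> a \<in> W x \<Longrightarrow> mem x a < 2 ^ w"
  shows "(\<Sum>x\<in>V. (1/2::real) ^ (probes q (mem x) + w * card (fresh_reads q (mem x) \<inter> W x))) \<le> 1"
  using assms
proof (induction q arbitrary: V mem W m0)
  case (Return r)
  then have "card V \<le> 1"
    \<comment> \<open>A leaf gives every member of \<open>V\<close> the same result, so injectivity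
      leaves at most one member.\<close>
    by (metis card_le_Suc0_iff_eq One_nat_def inj_on_def result.simps(1))
  then show ?case by simp
next
  case (Read a k)
  note fin = Read.prems(1) and inj = Read.prems(2) and eq = Read.prems(3) and less = Read.prems(4)
  let ?c = "\<lambda>x. probes (Read a k) (mem x) + w * card (fresh_reads (Read a k) (mem x) \<inter> W x)"
  define V0 where "V0 = {x\<in>V. a \<notin> W x}"
  define V1 where "V1 v = {x\<in>V - V0. mem x a = v}" for v
  have sub: "V0 \<subseteq> V" "\<And>v. V1 v \<subseteq> V" by (auto simp: V0_def V1_def)
  \<comment> \<open>All of \<open>V0\<close> finds \<open>m0 a\<close> in the cell and enters the
    same subtree; the factor 1/2 is the bit for the probe.\<close>
  have old: "(\<Sum>x\<in>V0. (1/2::real) ^ ?c x) \<le> 1/2"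
  proof -
    let ?d = "\<lambda>x. probes (k (m0 a)) (mem x) + w * card (fresh_reads (k (m0 a)) (mem x) \<inter> W x)"
    have "(\<Sum>x\<in>V0. (1/2::real) ^ ?c x) = (\<Sum>x\<in>V0. 1/2 * (1/2) ^ ?d x)"
      by (rule sum.cong) (auto simp: V0_def eq)
    also have "\<dots> = 1/2 * (\<Sum>x\<in>V0. (1/2) ^ ?d x)" by (simp only: sum_distrib_left)
    also have "(\<Sum>x\<in>V0. (1/2::real) ^ ?d x) \<le> 1"
    proof (rule Read.IH[OF rangeI])
      show "inj_on (\<lambda>x. result (k (m0 a)) (mem x)) V0"
        using inj by (auto simp: inj_on_def V0_def eq)
    qed (use sub fin eq less in \<open>auto intro: finite_subset\<close>)
    finally show ?thesis by simp
  qed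
  have new: "(\<Sum>x\<in>V1 v. (1/2::real) ^ ?c x) \<le> 1/2 * (1/2) ^ w" for v
  proof -
    \<comment> \<open>Throughout \<open>V1 v\<close> the cell \<open>a\<close> is now known to hold
      \<open>v\<close>, so it leaves \<open>W x\<close> and reading it again does not cost
      \<open>w\<close> bits.\<close>
    let ?d = "\<lambda>x. probes (k v) (mem x) + w * card (fresh_reads (k v) (mem x) \<inter> (W x - {a}))"
    have c: "?c x = Suc w + ?d x" if "x \<in> V1 v" for x
    proof -
      have "mem x a = v" "a \<in> W x" using that by (auto simp: V1_def V0_def)
      then have "fresh_reads (Read a k) (mem x) \<inter> W x =
          insert a (fresh_reads (k v) (mem x) \<inter> (W x - {a}))" by auto
      then have "card (fresh_reads (Read a k) (mem x) \<inter> W x) =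
          Suc (card (fresh_reads (k v) (mem x) \<inter> (W x - {a})))" by simp
      then show ?thesis using \<open>mem x a = v\<close> by (simp only: probes.simps) simp
    qed
    have "(\<Sum>x\<in>V1 v. (1/2::real) ^ ?c x) = (\<Sum>x\<in>V1 v. (1/2) ^ Suc w * (1/2) ^ ?d x)"
      by (rule sum.cong) (simp_all only: c power_add)
    also have "\<dots> = (1/2) ^ Suc w * (\<Sum>x\<in>V1 v. (1/2) ^ ?d x)" by (simp only: sum_distrib_left)
    also have "\<dots> \<le> (1/2) ^ Suc w * 1"
    proof (rule mult_left_mono, rule Read.IH[OF rangeI])
      show "inj_on (\<lambda>x. result (k v) (mem x)) (V1 v)"
        using inj by (auto simp: inj_on_def V1_def)
      show "mem x b = (m0(a := v)) b" if "x \<in> V1 v" "b \<notin> W x - {a}" for x b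
        using that eq by (auto simp: V1_def)
      show "mem x b < 2 ^ w" if "x \<in> V1 v" "b \<in> W x - {a}" for x b
        using that sub(2) less by blast
    qed (use sub fin in \<open>auto intro: finite_subset\<close>)
    finally show ?thesis by simp
  qed
  \<comment> \<open>At most \<open>2 ^ w\<close> values can be read, each with a share of
    \<open>1/2 * (1/2) ^ w\<close>: together the other half of the budget.\<close>
  have "(\<Sum>x\<in>V - V0. (1/2::real) ^ ?c x) = (\<Sum>v<2 ^ w. \<Sum>x\<in>V1 v. (1/2) ^ ?c x)"
    unfolding V1_def
    by (rule sum.group[symmetric]) (use fin less in \<open>auto simp: V0_def\<close>)
  also have "\<dots> \<le> (\<Sum>v<(2::nat) ^ w. 1/2 * (1/2) ^ w)" by (intro sum_mono new)
  also have "\<dots> = 1/2" by (simp add: power_one_over)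
  finally have "(\<Sum>x\<in>V - V0. (1/2::real) ^ ?c x) \<le> 1/2" .
  moreover have "(\<Sum>x\<in>V. (1/2::real) ^ ?c x) =
      (\<Sum>x\<in>V - V0. (1/2) ^ ?c x) + (\<Sum>x\<in>V0. (1/2) ^ ?c x)"
    by (rule sum.subset_diff) (use sub fin in auto)
  ultimately show ?case using old by linarith
next
  case (Write a v p)
  note fin = Write.prems(1) and inj = Write.prems(2) and eq = Write.prems(3)
    and less = Write.prems(4)
  let ?mem = "\<lambda>x. (mem x)(a := v)"
  let ?d = "\<lambda>x. probes p (?mem x) + w * card (fresh_reads p (?mem x) \<inter> (W x - {a}))"
  \<comment> \<open>Once overwritten, \<open>a\<close> has the same content for all of
    \<open>V\<close>. Dropping it from \<open>W x\<close> matches its removal from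
    \<open>fresh_reads\<close>.\<close>
  have [simp]: "(A - {a}) \<inter> W x = A \<inter> (W x - {a})" for A x by auto
  have "(\<Sum>x\<in>V. (1/2::real) ^ (probes (Write a v p) (mem x)
           + w * card (fresh_reads (Write a v p) (mem x) \<inter> W x))) = (\<Sum>x\<in>V. 1/2 * (1/2) ^ ?d x)"
    by simp
  also have "\<dots> \<le> (\<Sum>x\<in>V. (1/2) ^ ?d x)" by (intro sum_mono) simp
  also have "\<dots> \<le> 1"
  proof (rule Write.IH)
    show "?mem x b = (m0(a := v)) b" if "x \<in> V" "b \<notin> W x - {a}" for x b
      using that eq by auto
    show "inj_on (\<lambda>x. result p (?mem x)) V" using inj by (simp only: result.simps)
  qed (use fin less in auto)
  finally show ?case .
qed

text \<open>A source coding bound without entropy: \<open>1 + t \<le> 2 ^ t\<close> for integers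
  \<open>t\<close>, taken at \<open>t = K - c x\<close> and summed over \<open>V\<close>.\<close>

lemma sum_ge_of_kraft:
  fixes c :: "'x \<Rightarrow> nat"
  assumes "finite V" "card V = 2 ^ K" "(\<Sum>x\<in>V. (1/2::real) ^ c x) \<le> 1"
  shows "real K * 2 ^ K \<le> (\<Sum>x\<in>V. real (c x))"
proof -
  have le: "1 + real K - real (c x) \<le> 2 ^ K * (1/2) ^ c x" for x
  proof (cases "c x \<le> K")
    case True
    have "1 + real (K - c x) \<le> 2 ^ (K - c x)"
      using less_exp[of "K - c x"]
      by (metis Suc_leI of_nat_Suc of_nat_le_iff of_nat_numeral of_nat_power add.commute)
    also have "\<dots> = 2 ^ K * (1/2::real) ^ c x"
      using True by (simp add: power_diff power_one_over)
    finally show ?thesis using True by (simp add: of_nat_diff)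
  next
    case False
    then have "1 + real K - real (c x) \<le> 0" by linarith
    then show ?thesis by (rule order_trans) simp
  qed
  have "(\<Sum>x\<in>V. 1 + real K - real (c x)) \<le> (\<Sum>x\<in>V. 2 ^ K * (1/2) ^ c x)"
    by (intro sum_mono le)
  also have "\<dots> = 2 ^ K * (\<Sum>x\<in>V. (1/2) ^ c x)" by (simp only: sum_distrib_left)
  also have "\<dots> \<le> 2 ^ K * 1" by (intro mult_left_mono assms) simp
  finally show ?thesis
    using assms(2) by (simp add: sum.distrib sum_subtractf algebra_simps)
qed

section \<open>Operation sequences as programs\<close>

text \<open>Results are lists so that concatenation collects the query answers of a sequence;
  updates contribute nothing.\<close>

fun op_prog :: "cell_probe_ds \<Rightarrow> operation \<Rightarrow> real list prog" where
  "op_prog D (Insert x) = bind_prog (insert_prog D x) (\<lambda>_. Return [])"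
| "op_prog D (Delete x) = bind_prog (delete_prog D x) (\<lambda>_. Return [])"
| "op_prog D Query = bind_prog (query_prog D) (\<lambda>r. Return [r])"

primrec ops_prog :: "cell_probe_ds \<Rightarrow> operation list \<Rightarrow> real list prog" where
  "ops_prog D [] = Return []"
| "ops_prog D (c # cs) =
     bind_prog (op_prog D c) (\<lambda>r. bind_prog (ops_prog D cs) (\<lambda>s. Return (r @ s)))"

lemma final_memory_op_prog [simp]: "final_memory (op_prog D c) m = op_memory D c m"
  by (cases c) auto

lemma final_memory_ops_prog: "final_memory (ops_prog D cs) m = fold (op_memory D) cs m"
  by (induction cs arbitrary: m) auto

lemma probes_ops_prog: "probes (ops_prog D cs) m = probes_from D m cs"
proof -
  have "probes (op_prog D c) m = op_probes D c m" for c m by (cases c) auto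
  then show ?thesis by (induction cs arbitrary: m) auto
qed

lemma result_ops_prog_append:
  "result (ops_prog D (cs @ ds)) m =
     result (ops_prog D cs) m @ result (ops_prog D ds) (final_memory (ops_prog D cs) m)"
  by (induction cs arbitrary: m) auto

lemma probes_ops_prog_append:
  "probes (ops_prog D (cs @ ds)) m =
     probes (ops_prog D cs) m + probes (ops_prog D ds) (final_memory (ops_prog D cs) m)"
  by (induction cs arbitrary: m) auto

lemma fresh_reads_ops_prog_append:
  "fresh_reads (ops_prog D (cs @ ds)) m = fresh_reads (ops_prog D cs) m \<union>
     (fresh_reads (ops_prog D ds) (final_memory (ops_prog D cs) m) - written (ops_prog D cs) m)"
  by (induction cs arbitrary: m) auto

lemma memory_after_append:
  "memory_after D (cs @ ds) = final_memory (ops_prog D ds) (memory_after D cs)"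
  by (simp add: memory_after_def final_memory_ops_prog)

lemma fits_word_ops_prog: "word_size w D \<Longrightarrow> fits_word w (ops_prog D cs)"
proof -
  assume D: "word_size w D"
  have "fits_word w (op_prog D c)" for c
    using D by (cases c) (auto simp: word_size_def intro!: fits_word_bind)
  then show ?thesis by (induction cs) (auto intro!: fits_word_bind)
qed

lemma memory_after_less: "word_size w D \<Longrightarrow> memory_after D cs a < 2 ^ w"
  using final_memory_less[OF fits_word_ops_prog, of w D "init_memory D" cs a]
  by (auto simp: memory_after_def final_memory_ops_prog word_size_def)

lemma legal_append:
  "legal U S (cs @ ds) \<longleftrightarrow> legal U S cs \<and> legal U (current_set S cs) ds"
  by (induction U S cs rule: legal.induct) auto

lemma current_set_append: "current_set S (cs @ ds) = current_set (current_set S cs) ds"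
  by (induction S cs rule: current_set.induct) auto

section \<open>Prefix sums\<close>

definition prefix_sum :: "(nat \<times> nat) list \<Rightarrow> nat \<Rightarrow> nat" where
  "prefix_sum h r = sum_list (map snd (filter (\<lambda>p. fst p \<le> r) h))"

definition val_at :: "(nat \<times> nat) list \<Rightarrow> nat \<Rightarrow> nat" where
  "val_at h i = sum_list (map snd (filter (\<lambda>p. fst p = i) h))"

lemma prefix_sum_append [simp]: "prefix_sum (g @ h) r = prefix_sum g r + prefix_sum h r"
  by (simp add: prefix_sum_def)

lemma prefix_sum_eq_sum_val_at: "prefix_sum h r = (\<Sum>i\<le>r. val_at h i)"
proof (induction h)
  case (Cons p h)
  have "(\<Sum>i\<le>r. val_at (p # h) i) = (\<Sum>i\<le>r. (if i = fst p then snd p else 0) + val_at h i)"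
    by (intro sum.cong) (auto simp: val_at_def)
  also have "\<dots> = (if fst p \<le> r then snd p else 0) + prefix_sum h r"
    by (simp add: sum.distrib Cons)
  finally show ?case by (simp add: prefix_sum_def)
qed (simp add: prefix_sum_def val_at_def)

lemma val_at_eq_0: "i \<notin> fst ` set h \<Longrightarrow> val_at h i = 0"
  by (induction h) (auto simp: val_at_def)

text \<open>With distinct positions \<open>val_at\<close> recovers each single weight, and the
  common list of positions fixes the order.\<close>

lemma eq_of_val_at_eq:
  assumes "map fst g = map fst h" "distinct (map fst g)" "\<And>i. val_at g i = val_at h i"
  shows "g = h"
proof -
  have repr: "map (val_at f) (map fst f) = map snd f" if "distinct (map fst f)" for f
    using that
  proof (induction f)
    case (Cons p f)
    have "val_at (p # f) (fst p) = snd p"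
      using Cons.prems val_at_eq_0[of "fst p" f] by (auto simp: val_at_def)
    moreover have "map (val_at (p # f)) (map fst f) = map (val_at f) (map fst f)"
      using Cons.prems by (auto simp: val_at_def)
    ultimately show ?case using Cons by simp
  qed simp
  have "map snd g = map snd h"
    using repr[of g] repr[of h] assms by (metis (no_types, lifting) ext)
  with assms(1) show ?thesis by (metis zip_map_fst_snd)
qed

text \<open>Bit-reversed order: the halves in time are the even and the odd multiples of the step.\<close>

primrec positions :: "nat \<Rightarrow> nat \<Rightarrow> nat \<Rightarrow> nat list" where
  "positions 0 b s = [b]"
| "positions (Suc j) b s = positions j b (2 * s) @ positions j (b + s) (2 * s)"

lemma set_positions: "set (positions j b s) = (\<lambda>i. b + s * i) ` {..<2 ^ j}"
proof (induction j arbitrary: b s)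
  case (Suc j)
  show ?case
  proof (intro equalityI subsetI)
    fix x assume "x \<in> set (positions (Suc j) b s)"
    then consider i where "i < 2 ^ j" "x = b + s * (2 * i)"
      | i where "i < 2 ^ j" "x = b + s * (2 * i + 1)"
      by (auto simp: Suc algebra_simps)
    then show "x \<in> (\<lambda>i. b + s * i) ` {..<2 ^ Suc j}"
    proof cases
      case (1 i)
      then show ?thesis by (intro image_eqI[of _ _ "2 * i"]) auto
    next
      case (2 i)
      then show ?thesis by (intro image_eqI[of _ _ "2 * i + 1"]) auto
    qed
  next
    fix x assume "x \<in> (\<lambda>i. b + s * i) ` {..<2 ^ Suc j}"
    then obtain i where i: "i < 2 * 2 ^ j" "x = b + s * i" by auto
    then have "i div 2 < 2 ^ j" by auto
    moreover have "x = b + 2 * s * (i div 2) \<or> x = b + s + 2 * s * (i div 2)"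
    proof (cases "even i")
      case True
      then have "i = 2 * (i div 2)" by simp
      then show ?thesis using i(2) by (metis mult.assoc mult.left_commute)
    next
      case False
      then have "i = 1 + 2 * (i div 2)" by presburger
      then have "s * i = s + 2 * s * (i div 2)"
        by (metis distrib_left mult.assoc mult.left_commute mult.right_neutral)
      then show ?thesis using i(2) by simp
    qed
    ultimately show "x \<in> set (positions (Suc j) b s)" by (auto simp: Suc)
  qed
qed (simp add: lessThan_Suc)

lemma distinct_positions: "0 < s \<Longrightarrow> distinct (positions j b s)"
proof (induction j arbitrary: b s)
  case (Suc j)
  have "s * (2 * i) \<noteq> s * (1 + 2 * i')" for i i' :: nat
    using Suc.prems by (simp only: mult_cancel1) presburger
  then have "b + 2 * s * i \<noteq> b + s + 2 * s * i'" for i i'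
    by (simp add: algebra_simps)
  then show ?case using Suc by (auto simp: set_positions)
qed simp

text \<open>The sample space of the averaging argument, under uniform weights. It follows the
  recursion of \<open>positions\<close>, so the two halves of a segment vary independently.\<close>

primrec histories :: "nat \<Rightarrow> nat \<Rightarrow> nat \<Rightarrow> nat \<Rightarrow> (nat \<times> nat) list set" where
  "histories B 0 b s = (\<lambda>x. [(b, x)]) ` {1..B}"
| "histories B (Suc j) b s =
     (\<lambda>(g, h). g @ h) ` (histories B j b (2 * s) \<times> histories B j (b + s) (2 * s))"

lemma map_fst_histories: "h \<in> histories B j b s \<Longrightarrow> map fst h = positions j b s"
  by (induction j arbitrary: b s h) auto

lemma snd_histories: "h \<in> histories B j b s \<Longrightarrow> p \<in> set h \<Longrightarrow> snd p \<in> {1..B}"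
  by (induction j arbitrary: b s h) auto

lemma length_histories: "h \<in> histories B j b s \<Longrightarrow> length h = 2 ^ j"
  by (induction j arbitrary: b s h) auto

text \<open>First halves all have length \<open>2 ^ j\<close>, so a concatenation can be split in
  only one way.\<close>

lemma inj_append_histories:
  "inj_on (\<lambda>(g, h). g @ h) (histories B j b s \<times> histories B j b' s')"
  by (auto simp: inj_on_def dest!: length_histories)

lemma finite_histories [simp]: "finite (histories B j b s)"
  by (induction j arbitrary: b s) auto

lemma card_histories: "card (histories B j b s) = B ^ 2 ^ j"
proof (induction j arbitrary: b s)
  case 0
  have "card ((\<lambda>x. [(b, x)]) ` {1..B}) = card {1..B}"
    by (rule card_image) (auto simp: inj_on_def)
  then show ?case by simp
next
  case (Suc j)
  then show ?case
    by (simp add: card_image[OF inj_append_histories] card_cartesian_product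
        flip: power_add mult_2)
qed

lemma sum_histories_Suc:
  "(\<Sum>h\<in>histories B (Suc j) b s. f h) =
     (\<Sum>g\<in>histories B j b (2 * s). \<Sum>h\<in>histories B j (b + s) (2 * s). f (g @ h))"
  unfolding histories.simps sum.reindex[OF inj_append_histories] sum.cartesian_product
  by (simp add: case_prod_unfold)

text \<open>Prefix sums at interleaved positions determine the history. The sum at \<open>b + s * i + d\<close>
  separates position \<open>b + s * i\<close> from position \<open>b + s * (i + 1)\<close>.\<close>

lemma histories_eqI:
  assumes g: "g \<in> histories B j b s" and h: "h \<in> histories B j b s" and d: "d < s"
    and eq: "\<And>i. i < 2 ^ j \<Longrightarrow> prefix_sum g (b + s * i + d) = prefix_sum h (b + s * i + d)"
  shows "g = h"
proof (rule eq_of_val_at_eq)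
  have fst: "fst ` set f = (\<lambda>i. b + s * i) ` {..<2 ^ j}" if "f \<in> histories B j b s" for f
    using map_fst_histories[OF that] set_positions[of j b s] by (metis set_map)
  show "map fst g = map fst h" "distinct (map fst g)"
    using g h d by (simp_all add: map_fst_histories distinct_positions)
  \<comment> \<open>Proceeding from left to right solves a triangular system: once the smaller
    values agree, the sum up to \<open>x + d\<close> isolates the value at \<open>x\<close>.\<close>
  fix x show "val_at g x = val_at h x"
  proof (induction x rule: less_induct)
    case (less x)
    show ?case
    proof (cases "x \<in> (\<lambda>i. b + s * i) ` {..<2 ^ j}")
      case True
      then obtain i where i: "i < 2 ^ j" "x = b + s * i" by auto
      have gap: "y \<notin> (\<lambda>i. b + s * i) ` {..<2 ^ j}" if "x < y" "y \<le> x + d" for y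
      proof
        assume "y \<in> (\<lambda>i. b + s * i) ` {..<2 ^ j}"
        then obtain i' where "y = b + s * i'" by auto
        with that i d have "s * i < s * i'" "s * i' < s * (i + 1)" by auto
        then show False unfolding mult_less_cancel1 by linarith
      qed
      have split: "prefix_sum f (x + d) = (\<Sum>y<x. val_at f y) + val_at f x"
        if "f \<in> histories B j b s" for f
      proof -
        have "prefix_sum f (x + d) = (\<Sum>y\<le>x. val_at f y)"
          unfolding prefix_sum_eq_sum_val_at
        proof (rule sum.mono_neutral_right)
          show "\<forall>y\<in>{..x + d} - {..x}. val_at f y = 0"
          proof (intro ballI val_at_eq_0)
            fix y assume "y \<in> {..x + d} - {..x}"
            then have "x < y" "y \<le> x + d" by auto
            from gap[OF this] show "y \<notin> fst ` set f" by (simp only: fst[OF that] not_False_eq_True)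
          qed
        qed auto
        then show ?thesis by (simp add: lessThan_Suc_atMost[symmetric])
      qed
      show ?thesis using split[OF g] split[OF h] eq[OF i(1)] less by (simp add: i(2))
    next
      case False
      then show ?thesis by (simp add: val_at_eq_0 fst g h)
    qed
  qed
qed

section \<open>Prefix sums as independent sets\<close>

text \<open>Intervals are closed, so touching ones would conflict; even left end points leave a gap
  between neighbours.\<close>

definition unit_ival :: "nat \<Rightarrow> nat \<Rightarrow> wival" where
  "unit_ival i x = (real (2 * i), real (2 * i + 1), real x)"

text \<open>It begins beyond the end of unit interval \<open>i\<close> and so conflicts, among
  positions below \<open>2 ^ k\<close>, exactly with those greater than \<open>i\<close>.\<close>

definition heavy_ival :: "nat \<Rightarrow> nat \<Rightarrow> wival" where
  "heavy_ival N i = (real (2 * i + 2), real N, real N)"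

definition step_ops :: "nat \<Rightarrow> nat \<times> nat \<Rightarrow> operation list" where
  "step_ops N p = [Insert (unit_ival (fst p) (snd p)), Insert (heavy_ival N (fst p)), Query,
     Delete (heavy_ival N (fst p))]"

definition history_ops :: "nat \<Rightarrow> (nat \<times> nat) list \<Rightarrow> operation list" where
  "history_ops N h = concat (map (step_ops N) h)"

lemma history_ops_Nil [simp]: "history_ops N [] = []"
  by (simp add: history_ops_def)

lemma history_ops_append [simp]: "history_ops N (g @ h) = history_ops N g @ history_ops N h"
  by (simp add: history_ops_def)

text \<open>Positions and weights are both bounded by \<open>2 ^ k\<close>, so that by \<open>N_ge\<close> the weight \<open>N\<close> of a
  heavy interval is at least that of all unit intervals together.\<close>

locale mwis_structure =
  fixes N k w :: nat and U :: "wival set" and D :: cell_probe_ds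
  assumes N_gt: "2 * 2 ^ k < N" and N_ge: "2 ^ k * 2 ^ k \<le> N"
    and inputs: "grid_wivals N \<subseteq> U"
    and cells: "word_size w D"
    and correct: "solves_dynamic_mwis U D"
begin

definition valid :: "(nat \<times> nat) list \<Rightarrow> bool" where
  "valid h \<longleftrightarrow> distinct (map fst h) \<and> (\<forall>p\<in>set h. fst p < 2 ^ k \<and> snd p \<in> {1..2 ^ k})"

lemma valid_appendD: "valid (g @ h) \<Longrightarrow> valid g"
  by (auto simp: valid_def)

lemma unit_in_U: "i < 2 ^ k \<Longrightarrow> x \<in> {1..2 ^ k} \<Longrightarrow> unit_ival i x \<in> U"
proof -
  assume "i < 2 ^ k" "x \<in> {1..2 ^ k}"
  then have "2 * i < 2 * i + 1" "2 * i + 1 \<le> N" "1 \<le> x" "x \<le> N" using N_gt by auto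
  then have "unit_ival i x \<in> grid_wivals N" unfolding unit_ival_def grid_wivals_def by blast
  then show ?thesis using inputs by blast
qed

lemma heavy_in_U: "i < 2 ^ k \<Longrightarrow> heavy_ival N i \<in> U"
proof -
  assume "i < 2 ^ k"
  then have "2 * i + 2 < N" "N \<le> N" "1 \<le> N" using N_gt by auto
  then have "heavy_ival N i \<in> grid_wivals N" unfolding heavy_ival_def grid_wivals_def by blast
  then show ?thesis using inputs by blast
qed

text \<open>The right end points differ, since \<open>2 * i' + 1 < N\<close>. This keeps the
  insertions legal and lets deletion restore the unit intervals.\<close>

lemma heavy_neq_unit: "i' < 2 ^ k \<Longrightarrow> heavy_ival N i \<noteq> unit_ival i' x"
proof
  assume "i' < 2 ^ k" "heavy_ival N i = unit_ival i' x"
  then have "N = 2 * i' + 1" unfolding heavy_ival_def unit_ival_def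
    by (metis Pair_inject of_nat_eq_iff)
  then show False using N_gt \<open>i' < 2 ^ k\<close> by linarith
qed

abbreviation units :: "(nat \<times> nat) list \<Rightarrow> wival set" where
  "units h \<equiv> (\<lambda>p. unit_ival (fst p) (snd p)) ` set h"

lemma heavy_notin_units: "valid h \<Longrightarrow> heavy_ival N i \<notin> units h"
  using heavy_neq_unit by (auto simp: valid_def)

lemma history_ops_legal:
  assumes "valid h"
  shows "legal U {} (history_ops N h) \<and> current_set {} (history_ops N h) = units h"
  using assms
proof (induction h rule: rev_induct)
  case Nil
  then show ?case by (simp add: history_ops_def)
next
  case (snoc p h)
  have "valid h" using snoc.prems by (rule valid_appendD)
  note IH = snoc.IH[OF this]
  have p: "fst p < 2 ^ k" "snd p \<in> {1..2 ^ k}" "fst p \<notin> fst ` set h"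
    using snoc.prems by (auto simp: valid_def)
  have "unit_ival (fst p) (snd p) \<notin> units h"
    using p(3) by (auto simp: unit_ival_def)
  moreover have "heavy_ival N (fst p) \<notin> insert (unit_ival (fst p) (snd p)) (units h)"
    using heavy_notin_units[OF snoc.prems, of "fst p"] by auto
  ultimately show ?case
    using IH unit_in_U[OF p(1,2)] heavy_in_U[OF p(1)]
    by (auto simp: legal_append current_set_append history_ops_def step_ops_def)
qed

lemma sum_weight_units:
  assumes "valid h" "P = (\<lambda>p. Q (fst p))"
  shows "(\<Sum>y\<in>(\<lambda>p. unit_ival (fst p) (snd p)) ` {p \<in> set h. P p}. weight y) =
    real (sum_list (map snd (filter P h)))"
proof -
  have inj: "inj_on (\<lambda>p. unit_ival (fst p) (snd p)) {p \<in> set h. P p}"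
    by (auto simp: inj_on_def unit_ival_def prod_eq_iff)
  have "distinct h" using assms by (auto simp: valid_def distinct_map)
  have "(\<Sum>y\<in>(\<lambda>p. unit_ival (fst p) (snd p)) ` {p \<in> set h. P p}. weight y) =
      (\<Sum>p\<in>{p \<in> set h. P p}. real (snd p))"
    by (subst sum.reindex[OF inj]) (simp add: weight_def unit_ival_def)
  also have "\<dots> = real (\<Sum>p\<in>set (filter P h). snd p)" by simp
  also have "\<dots> = real (sum_list (map snd (filter P h)))"
    using \<open>distinct h\<close> by (subst sum_list_distinct_conv_sum_set) auto
  finally show ?thesis .
qed

lemma sum_units_le:
  assumes "valid h"
  shows "(\<Sum>y\<in>units h. weight y) \<le> real N"
proof -
  have "length h = card (fst ` set h)"
    using assms distinct_card[of "map fst h"] by (simp add: valid_def)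
  also have "\<dots> \<le> card {..<(2::nat) ^ k}"
    using assms by (intro card_mono) (auto simp: valid_def)
  finally have len: "length h \<le> 2 ^ k" by simp
  have "(\<Sum>y\<in>units h. weight y) = real (sum_list (map snd h))"
    using sum_weight_units[OF assms, of "\<lambda>_. True" "\<lambda>_. True"] by simp
  also have "sum_list (map snd h) \<le> (\<Sum>p\<leftarrow>h. 2 ^ k)"
    using assms by (intro sum_list_mono) (auto simp: valid_def)
  also have "\<dots> = length h * 2 ^ k" by (simp add: sum_list_triv)
  also have "\<dots> \<le> 2 ^ k * 2 ^ k" using len by simp
  also have "\<dots> \<le> N" by (rule N_ge)
  finally show ?thesis by simp
qed

lemma weight_nonneg: "y \<in> units h \<Longrightarrow> 0 \<le> weight y"
  by (auto simp: weight_def unit_ival_def)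

text \<open>An independent set with the heavy interval can only add unit intervals at positions up
  to \<open>i\<close>; one without it weighs at most \<open>N\<close> altogether.\<close>

lemma mwis_heavy:
  assumes "valid h"
  shows "mwis (insert (heavy_ival N i) (units h)) = real N + real (prefix_sum h i)"
proof -
  let ?H = "heavy_ival N i"
  define P where "P = (\<lambda>p. unit_ival (fst p) (snd p)) ` {p \<in> set h. fst p \<le> i}"
  have P: "(\<Sum>y\<in>P. weight y) = real (prefix_sum h i)"
    using sum_weight_units[OF assms, of "\<lambda>p. fst p \<le> i" "\<lambda>j. j \<le> i"]
    by (simp add: P_def prefix_sum_def)
  have "P \<subseteq> units h" by (auto simp: P_def)
  then have "finite P" "?H \<notin> P" using heavy_notin_units[OF assms, of i] by (auto intro: finite_subset)
  have H: "weight ?H = real N" by (simp add: weight_def heavy_ival_def)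
  have disj: "disjnt (ival (unit_ival a x)) (ival (unit_ival b y))" if "a \<noteq> b" for a b x y
  proof -
    have "real (2 * a + 1) < real (2 * b) \<or> real (2 * b + 1) < real (2 * a)"
      unfolding of_nat_less_iff using that by linarith
    then show ?thesis by (auto simp: disjnt_def ival_def unit_ival_def)
  qed
  have indep: "independent (insert ?H P)"
    unfolding independent_def pairwise_insert
  proof (intro conjI ballI impI allI)
    show "pairwise (\<lambda>x y. disjnt (ival x) (ival y)) P"
    proof (rule pairwiseI)
      fix x y assume xy: "x \<in> P" "y \<in> P" "x \<noteq> y"
      then obtain p q where pq: "p \<in> set h" "q \<in> set h" "x = unit_ival (fst p) (snd p)"
        "y = unit_ival (fst q) (snd q)" by (auto simp: P_def)
      moreover have "fst p \<noteq> fst q"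
        using pq xy(3) assms unfolding valid_def by (metis distinct_map inj_onD)
      ultimately show "disjnt (ival x) (ival y)" using disj by simp
    qed
    show "disjnt (ival ?H) (ival y)" "disjnt (ival y) (ival ?H)" if "y \<in> P \<and> y \<noteq> ?H" for y
      using that by (auto simp: P_def disjnt_def ival_def unit_ival_def heavy_ival_def)
  qed
  let ?A = "{(\<Sum>x\<in>J. weight x) | J. J \<subseteq> insert ?H (units h) \<and> independent J}"
  have "?A = (\<lambda>J. \<Sum>x\<in>J. weight x) ` {J. J \<subseteq> insert ?H (units h) \<and> independent J}" by blast
  then have "finite ?A" by simp
  show ?thesis unfolding mwis_def
  proof (rule Max_eqI)
    show "finite ?A" by fact
    have "(\<Sum>y\<in>insert ?H P. weight y) = real N + real (prefix_sum h i)"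
      using \<open>finite P\<close> \<open>?H \<notin> P\<close> by (simp add: H P)
    then show "real N + real (prefix_sum h i) \<in> ?A"
      using indep \<open>P \<subseteq> units h\<close> by (intro CollectI exI[of _ "insert ?H P"]) auto
  next
    fix z assume "z \<in> ?A"
    then obtain J where J: "z = (\<Sum>x\<in>J. weight x)" "J \<subseteq> insert ?H (units h)" "independent J"
      by auto
    have "finite J" using J(2) by (rule finite_subset) simp
    show "z \<le> real N + real (prefix_sum h i)"
    proof (cases "?H \<in> J")
      case True
      have "J - {?H} \<subseteq> P"
      proof
        fix y assume y: "y \<in> J - {?H}"
        then obtain p where p: "p \<in> set h" "y = unit_ival (fst p) (snd p)" using J(2) by auto
        have dis: "disjnt (ival ?H) (ival y)"
          using J(3) True y by (auto simp: independent_def pairwise_def)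
        have "fst p < 2 ^ k" using p(1) assms by (auto simp: valid_def)
        then have "2 * fst p + 1 \<le> N" using N_gt by linarith
        then have "real (2 * fst p) \<le> real N" unfolding of_nat_le_iff by linarith
        have "fst p \<le> i"
        proof (rule ccontr)
          assume "\<not> fst p \<le> i"
          then have "real (2 * i + 2) \<le> real (2 * fst p)" unfolding of_nat_le_iff by linarith
          \<comment> \<open>The left end point of a unit interval too far right is a common point of
            both intervals.\<close>
          then have "real (2 * fst p) \<in> ival ?H \<inter> ival y"
            using \<open>real (2 * fst p) \<le> real N\<close> by (auto simp: p(2) ival_def heavy_ival_def unit_ival_def)
          then show False using dis by (auto simp: disjnt_def)
        qed
        then show "y \<in> P" using p by (auto simp: P_def)
      qed
      then have "(\<Sum>y\<in>J - {?H}. weight y) \<le> (\<Sum>y\<in>P. weight y)"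
        by (intro sum_mono2) (use \<open>finite P\<close> \<open>P \<subseteq> units h\<close> weight_nonneg in blast)+
      then show ?thesis
        using True \<open>finite J\<close> by (simp add: J(1) P H sum.remove)
    next
      case False
      then have "J \<subseteq> units h" using J(2) by blast
      then have "(\<Sum>y\<in>J. weight y) \<le> (\<Sum>y\<in>units h. weight y)"
        by (intro sum_mono2 weight_nonneg) auto
      also have "\<dots> \<le> real N" by (rule sum_units_le[OF assms])
      finally show ?thesis by (simp add: J(1))
    qed
  qed
qed

section \<open>Information transfer\<close>

abbreviation run :: "(nat \<times> nat) list \<Rightarrow> real list prog" where
  "run h \<equiv> ops_prog D (history_ops N h)"

abbreviation mem_after :: "(nat \<times> nat) list \<Rightarrow> memory" where
  "mem_after h \<equiv> memory_after D (history_ops N h)"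

primrec answers :: "(nat \<times> nat) list \<Rightarrow> (nat \<times> nat) list \<Rightarrow> real list" where
  "answers g [] = []"
| "answers g (p # h) = (real N + real (prefix_sum (g @ [p]) (fst p))) # answers (g @ [p]) h"

lemma result_run: "valid (g @ h) \<Longrightarrow> result (run h) (mem_after g) = answers g h"
proof (induction h arbitrary: g)
  case Nil
  then show ?case by (simp add: history_ops_def)
next
  case (Cons p h)
  \<comment> \<open>The operations up to just before the query of this step, when the heavy interval
    is present.\<close>
  let ?cs = "history_ops N g @ [Insert (unit_ival (fst p) (snd p)), Insert (heavy_ival N (fst p))]"
  have v: "valid (g @ [p])" by (rule valid_appendD[of _ h]) (use Cons.prems in simp)
  note g = history_ops_legal[OF valid_appendD[OF v]]
  note gp = history_ops_legal[OF v]
  have leg: "legal U {} ?cs" and cur: "current_set {} ?cs = insert (heavy_ival N (fst p)) (units (g @ [p]))"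
    using g gp by (auto simp: legal_append current_set_append history_ops_def step_ops_def)
  have "result (query_prog D) (memory_after D ?cs) = mwis (current_set {} ?cs)"
    using correct leg unfolding solves_dynamic_mwis_def by blast
  also have "\<dots> = mwis (insert (heavy_ival N (fst p)) (units (g @ [p])))" by (simp only: cur)
  also have "\<dots> = real N + real (prefix_sum (g @ [p]) (fst p))" by (rule mwis_heavy[OF v])
  finally have q: "result (query_prog D) (memory_after D ?cs) =
      real N + real (prefix_sum (g @ [p]) (fst p))" .
  have "result (ops_prog D (step_ops N p)) (mem_after g) =
      [real N + real (prefix_sum (g @ [p]) (fst p))]"
    unfolding q[symmetric] by (simp add: step_ops_def memory_after_def)
  moreover have "result (run h) (mem_after (g @ [p])) = answers (g @ [p]) h"
    using Cons.IH[of "g @ [p]"] Cons.prems by simp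
  moreover have "history_ops N (p # h) = step_ops N p @ history_ops N h"
    "mem_after (g @ [p]) = memory_after D (history_ops N g @ step_ops N p)"
    by (simp_all add: history_ops_def)
  ultimately show ?case
    by (simp only: answers.simps result_ops_prog_append memory_after_append append.simps)
qed

text \<open>The entries of \<open>v\<close> inserted before the query at \<open>i\<close> are the
  same in both runs and cancel.\<close>

lemma prefix_sum_eq_of_answers_eq:
  "answers g v = answers g' v \<Longrightarrow> i \<in> fst ` set v \<Longrightarrow> prefix_sum g i = prefix_sum g' i"
proof (induction v arbitrary: g g')
  case (Cons p v)
  show ?case
  proof (cases "i = fst p")
    case True
    then show ?thesis using Cons.prems by simp
  next
    case False
    then have "prefix_sum (g @ [p]) i = prefix_sum (g' @ [p]) i"
      using Cons.prems by (intro Cons.IH) auto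
    then show ?thesis by simp
  qed
qed simp

text \<open>With \<open>g\<close> and \<open>v\<close> fixed, the answers during \<open>v\<close>
  encode \<open>u\<close>, one of \<open>2 ^ (k * 2 ^ j)\<close> histories, so \<open>c\<close> is
  on average at least \<open>k * 2 ^ j\<close>.\<close>

lemma transfer_bound:
  assumes v: "v \<in> histories (2 ^ k) j (b + s) (2 * s)" and s: "0 < s"
    and valid: "\<And>u. u \<in> histories (2 ^ k) j b (2 * s) \<Longrightarrow> valid (g @ u @ v)"
  defines "c \<equiv> \<lambda>u. probes (run v) (mem_after (g @ u)) +
      w * card (fresh_reads (run v) (mem_after (g @ u)) \<inter> written (run u) (mem_after g))"
  shows "real (k * 2 ^ j) * 2 ^ (k * 2 ^ j) \<le> (\<Sum>u\<in>histories (2 ^ k) j b (2 * s). real (c u))"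
proof (rule sum_ge_of_kraft)
  let ?V = "histories (2 ^ k) j b (2 * s)"
  show "finite ?V" by simp
  show "card ?V = 2 ^ (k * 2 ^ j)" by (simp add: card_histories power_mult)
  show "(\<Sum>u\<in>?V. (1/2::real) ^ c u) \<le> 1" unfolding c_def
  \<comment> \<open>The known memory is the one after \<open>g\<close>; only cells written during
    \<open>u\<close> can deviate from it.\<close>
  proof (rule kraft_prog)
    show "inj_on (\<lambda>u. result (run v) (mem_after (g @ u))) ?V"
    proof (rule inj_onI)
      fix u u' assume u: "u \<in> ?V" "u' \<in> ?V"
        and "result (run v) (mem_after (g @ u)) = result (run v) (mem_after (g @ u'))"
      then have eq: "answers (g @ u) v = answers (g @ u') v"
        using result_run[of "g @ u" v] result_run[of "g @ u'" v] valid by simp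
      show "u = u'"
      \<comment> \<open>The positions of \<open>u\<close> have step \<open>2 * s\<close>, and those
        of \<open>v\<close> lie halfway between, at offset \<open>s\<close>.\<close>
      proof (rule histories_eqI[OF u, of s])
        fix i :: nat assume "i < 2 ^ j"
        then have "b + 2 * s * i + s \<in> set (positions j (b + s) (2 * s))"
          by (auto simp: set_positions algebra_simps)
        then have "b + 2 * s * i + s \<in> fst ` set v"
          using map_fst_histories[OF v] by (metis set_map)
        from prefix_sum_eq_of_answers_eq[OF eq this]
        show "prefix_sum u (b + 2 * s * i + s) = prefix_sum u' (b + 2 * s * i + s)" by simp
      qed (use s in simp)
    qed
    show "mem_after (g @ u) a = mem_after g a" if "a \<notin> written (run u) (mem_after g)" for u a
      using that by (simp add: memory_after_append final_memory_not_written)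
  qed (use cells in \<open>auto intro: memory_after_less\<close>)
qed

text \<open>The fresh reads are subtracted since they may still be charged \<open>w\<close> bits by a larger segment.
  This makes the costs of the two halves and of the transfer between them add up.\<close>

lemma average_cost_ge:
  assumes "0 < s" and "\<And>h. h \<in> histories (2 ^ k) j b s \<Longrightarrow> valid (g @ h)"
  shows "2 ^ (k * 2 ^ j) * (real k * real j * 2 ^ j) \<le>
    2 * (\<Sum>h\<in>histories (2 ^ k) j b s. (real j + real w) * real (probes (run h) (mem_after g))
           - real w * real (card (fresh_reads (run h) (mem_after g))))"
  using assms
proof (induction j arbitrary: b s g)
  \<comment> \<open>The left side vanishes, and the right side is nonnegative as fresh reads are at
    most the probes.\<close>
  case 0
  have "0 \<le> real w * real (probes (run h) m) - real w * real (card (fresh_reads (run h) m))" for h m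
    using card_fresh_reads_le[of "run h" m] by (simp add: mult_left_mono)
  then show ?case by (auto intro!: sum_nonneg)
next
  case (Suc j)
  let ?X = "histories (2 ^ k) j b (2 * s)" and ?Y = "histories (2 ^ k) j (b + s) (2 * s)"
  define T where "T h g = real (probes (run h) (mem_after g))" for h g
  define F where "F h g = real (card (fresh_reads (run h) (mem_after g)))" for h g
  define C where "C h g = (real j + real w) * T h g - real w * F h g" for h g
  define I where "I u v = card (fresh_reads (run v) (mem_after (g @ u)) \<inter>
      written (run u) (mem_after g))" for u v
  have card: "real (card (histories (2 ^ k) j b' s')) = 2 ^ (k * 2 ^ j)" for b' s'
    by (simp add: card_histories power_mult)
  have valid: "valid (g @ u @ v)" if "u \<in> ?X" "v \<in> ?Y" for u v
    using that by (intro Suc.prems) (auto intro!: image_eqI)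
  have "?Y \<noteq> {}" using card[of "b + s" "2 * s"] by (auto simp del: histories.simps)
  then have "valid (g @ u)" if "u \<in> ?X" for u
    using valid[OF that] valid_appendD[of "g @ u"] by fastforce
  then have L: "2 ^ (k * 2 ^ j) * (real k * real j * 2 ^ j) \<le> 2 * (\<Sum>u\<in>?X. C u g)"
    unfolding C_def T_def F_def using Suc.prems(1)
    by (intro Suc.IH) auto
  have R: "2 ^ (k * 2 ^ j) * (real k * real j * 2 ^ j) \<le> 2 * (\<Sum>v\<in>?Y. C v (g @ u))"
    if "u \<in> ?X" for u
    unfolding C_def T_def F_def using Suc.prems(1) valid that by (intro Suc.IH) auto
  have M: "2 ^ (k * 2 ^ j) * (real k * 2 ^ j) \<le>
      (\<Sum>u\<in>?X. T v (g @ u) + real w * real (I u v))" if "v \<in> ?Y" for v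
    using transfer_bound[OF that Suc.prems(1), of g] valid that
    by (simp add: T_def I_def algebra_simps)
  \<comment> \<open>Reads of \<open>v\<close> that hit cells written by \<open>u\<close> are not
    fresh for \<open>u @ v\<close>; this frees the \<open>w\<close> bits for the transfer. The extra
    bit per probe of \<open>v\<close> raises \<open>j\<close> to \<open>Suc j\<close>.\<close>
  have S: "C u g + C v (g @ u) + (T v (g @ u) + real w * real (I u v)) \<le>
      (real (Suc j) + real w) * T (u @ v) g - real w * F (u @ v) g" for u v
  proof -
    have T: "T (u @ v) g = T u g + T v (g @ u)"
      by (simp add: T_def probes_ops_prog_append memory_after_append)
    let ?A = "fresh_reads (run u) (mem_after g)" and ?B = "fresh_reads (run v) (mem_after (g @ u))"
    let ?W = "written (run u) (mem_after g)"
    have "fresh_reads (run (u @ v)) (mem_after g) = ?A \<union> (?B - ?W)"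
      by (simp add: fresh_reads_ops_prog_append memory_after_append)
    then have "card (fresh_reads (run (u @ v)) (mem_after g)) \<le> card ?A + card (?B - ?W)"
      by (simp add: card_Un_le)
    moreover have "card ?B = card (?B - ?W) + card (?B \<inter> ?W)"
      using card_Diff_subset_Int[of ?B ?W] card_mono[of ?B "?B \<inter> ?W"] by simp
    ultimately have "F (u @ v) g + real (I u v) \<le> F u g + F v (g @ u)"
      unfolding F_def I_def by linarith
    then have "real w * (F (u @ v) g + real (I u v)) \<le> real w * (F u g + F v (g @ u))"
      by (rule mult_left_mono) simp
    moreover have "0 \<le> T u g" by (simp add: T_def)
    ultimately show ?thesis by (simp add: C_def T algebra_simps)
  qed
  let ?c = "2 ^ (k * 2 ^ j) :: real"
  have "?c * (?c * (real k * real j * 2 ^ j)) \<le> ?c * (2 * (\<Sum>u\<in>?X. C u g))"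
    using L by (intro mult_left_mono) auto
  also have "\<dots> = 2 * (\<Sum>u\<in>?X. \<Sum>v\<in>?Y. C u g)"
    using card[of "b + s" "2 * s"] by (simp flip: sum_distrib_left)
  finally have 1: "?c * (?c * (real k * real j * 2 ^ j)) \<le> 2 * (\<Sum>u\<in>?X. \<Sum>v\<in>?Y. C u g)" .
  have "?c * (?c * (real k * real j * 2 ^ j)) = (\<Sum>u\<in>?X. ?c * (real k * real j * 2 ^ j))"
    using card[of b "2 * s"] by simp
  also have "\<dots> \<le> (\<Sum>u\<in>?X. 2 * (\<Sum>v\<in>?Y. C v (g @ u)))" by (intro sum_mono R)
  finally have 2: "?c * (?c * (real k * real j * 2 ^ j)) \<le> 2 * (\<Sum>u\<in>?X. \<Sum>v\<in>?Y. C v (g @ u))"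
    by (simp only: sum_distrib_left)
  have "?c * (?c * (real k * 2 ^ j)) = (\<Sum>v\<in>?Y. ?c * (real k * 2 ^ j))"
    using card[of "b + s" "2 * s"] by simp
  also have "\<dots> \<le> (\<Sum>v\<in>?Y. \<Sum>u\<in>?X. T v (g @ u) + real w * real (I u v))" by (intro sum_mono M)
  also have "\<dots> = (\<Sum>u\<in>?X. \<Sum>v\<in>?Y. T v (g @ u) + real w * real (I u v))" by (rule sum.swap)
  finally have 3: "?c * (?c * (real k * 2 ^ j)) \<le> \<dots>" .
  \<comment> \<open>The average cost obeys \<open>a (j + 1) = 2 * a j + k * 2 ^ j\<close>, solved by
    \<open>k * j * 2 ^ j / 2\<close>; hence the factor 2 on the right.\<close>
  have "2 ^ (k * 2 ^ Suc j) * (real k * real (Suc j) * 2 ^ Suc j) =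
      ?c * (?c * (real k * real j * 2 ^ j)) + ?c * (?c * (real k * real j * 2 ^ j)) +
      2 * (?c * (?c * (real k * 2 ^ j)))"
  proof -
    have "k * 2 ^ Suc j = k * 2 ^ j + k * 2 ^ j" by simp
    then have "2 ^ (k * 2 ^ Suc j) = ?c * ?c" by (simp only: power_add)
    then show ?thesis by (simp only: of_nat_Suc power_Suc) (simp only: algebra_simps mult_2 mult_1)
  qed
  also have "\<dots> \<le> 2 * (\<Sum>u\<in>?X. \<Sum>v\<in>?Y. C u g + C v (g @ u) + (T v (g @ u) + real w * real (I u v)))"
  proof -
    have "(\<Sum>u\<in>?X. \<Sum>v\<in>?Y. C u g + C v (g @ u) + (T v (g @ u) + real w * real (I u v))) =
        (\<Sum>u\<in>?X. \<Sum>v\<in>?Y. C u g) + (\<Sum>u\<in>?X. \<Sum>v\<in>?Y. C v (g @ u)) +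
        (\<Sum>u\<in>?X. \<Sum>v\<in>?Y. T v (g @ u) + real w * real (I u v))"
      by (simp only: sum.distrib)
    then show ?thesis using 1 2 3 by linarith
  qed
  also have "\<dots> \<le> 2 * (\<Sum>u\<in>?X. \<Sum>v\<in>?Y. (real (Suc j) + real w) * T (u @ v) g - real w * F (u @ v) g)"
    by (intro mult_left_mono sum_mono S) simp
  finally show ?case
    by (simp only: sum_histories_Suc T_def F_def)
qed

text \<open>The recursion is used to depth \<open>k\<close> from the initial memory. The constant is
  the factor 2 from there times four operations per step.\<close>

lemma time_ge:
  assumes "amortized_time U D tu tq"
  shows "(real k)\<^sup>2 \<le> 8 * (real k + real w) * max tu tq"
proof -
  let ?H = "histories (2 ^ k) k 0 1"
  define M where "M = max tu tq"
  have M: "tu \<le> M" "tq \<le> M" by (simp_all add: M_def)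
  have valid: "valid ([] @ h)" if "h \<in> ?H" for h
  proof -
    have "fst ` set h = set (positions k 0 1)"
      using map_fst_histories[OF that] by (metis set_map)
    then have "fst ` set h = {..<2 ^ k}" by (simp add: set_positions)
    then show ?thesis
      using map_fst_histories[OF that] snd_histories[OF that] distinct_positions[of 1 k 0]
      by (auto simp: valid_def)
  qed
  have le: "real (probes (run h) (mem_after [])) \<le> 4 * 2 ^ k * M" if "h \<in> ?H" for h
  proof -
    have count: "length (filter (\<lambda>c. \<not> is_query c) (history_ops N f)) = 3 * length f"
      "length (filter is_query (history_ops N f)) = length f" for f
      by (induction f) (auto simp: history_ops_def step_ops_def)
    have "legal U {} (history_ops N h)" using history_ops_legal valid[OF that] by simp
    then have "real (total_probes D (history_ops N h)) \<le>
        tu * real (length (filter (\<lambda>c. \<not> is_query c) (history_ops N h))) +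
        tq * real (length (filter is_query (history_ops N h)))"
      using assms unfolding amortized_time_def by blast
    also have "\<dots> = tu * real (3 * length h) + tq * real (length h)" by (simp only: count)
    also have "\<dots> \<le> M * real (3 * length h) + M * real (length h)"
      by (intro add_mono mult_right_mono M) auto
    also have "\<dots> = 4 * 2 ^ k * M" by (simp add: length_histories[OF that])
    finally show ?thesis by (simp add: total_probes_def probes_ops_prog memory_after_def)
  qed
  have card: "real (card ?H) = 2 ^ (k * 2 ^ k)" by (simp add: card_histories power_mult)
  have "2 ^ (k * 2 ^ k) * (real k * real k * 2 ^ k) \<le>
    2 * (\<Sum>h\<in>?H. (real k + real w) * real (probes (run h) (mem_after []))
           - real w * real (card (fresh_reads (run h) (mem_after []))))"
    by (rule average_cost_ge) (use valid in auto)
  also have "\<dots> \<le> 2 * (\<Sum>h\<in>?H. (real k + real w) * (4 * 2 ^ k * M) - 0)"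
    using le by (intro mult_left_mono sum_mono diff_mono) auto
  also have "\<dots> = 2 ^ (k * 2 ^ k) * (8 * (real k + real w) * M * 2 ^ k)"
    by (simp only: sum_constant card diff_zero) (simp only: mult_ac)
  finally have "real k * real k * 2 ^ k \<le> 8 * (real k + real w) * M * 2 ^ k"
    by (rule mult_left_le_imp_le) simp
  then have "real k * real k \<le> 8 * (real k + real w) * M"
    by (rule mult_right_le_imp_le) simp
  then show ?thesis unfolding power2_eq_square M_def .
qed

end

section \<open>The lower bound\<close>

text \<open>Half of the binary logarithm of \<open>N\<close> serves: \<open>2 ^ k\<close> weights of
  at most \<open>2 ^ k\<close> then sum to at most \<open>N\<close>.\<close>

lemma exists_exponent:
  assumes "16 \<le> N"
  obtains k :: nat where "2 * 2 ^ k < N" "2 ^ k * 2 ^ k \<le> N"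
    "ln (real N) \<le> 4 * real k" "real k \<le> ln (real N)"
proof -
  obtain K where K: "2 ^ K \<le> N" "N < 2 ^ (K + 1)"
    using ex_power_ivl1[of 2 N] assms by auto
  have "(2::nat) ^ 4 < 2 ^ (K + 1)" using K(2) assms by simp
  then have "4 < K + 1" by (rule power_less_imp_less_exp[rotated]) simp
  define k where "k = K div 2"
  have k: "2 \<le> k" "2 * k \<le> K" "K + 1 \<le> 2 * k + 2" using \<open>4 < K + 1\<close> by (auto simp: k_def)
  have "(2::nat) ^ (2 * k) \<le> 2 ^ K" "(2::nat) ^ (k + 1) < 2 ^ (2 * k)" "(2::nat) ^ (K + 1) \<le> 2 ^ (2 * k + 2)"
    using k by (auto intro!: power_increasing power_strict_increasing simp del: power_Suc)
  then have N: "2 ^ (2 * k) \<le> N" "2 ^ (k + 1) < N" "N \<le> 2 ^ (2 * k + 2)"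
    using K by linarith+
  have "real N \<le> real (2 ^ (2 * k + 2))" using N(3) by (simp only: of_nat_le_iff)
  then have "ln (real N) \<le> ln (2 ^ (2 * k + 2))" using assms by simp
  also have "\<dots> = real (2 * k + 2) * ln 2" by (rule ln_realpow)
  also have "\<dots> \<le> real (2 * k + 2) * 1" using ln_2_less_1 by (intro mult_left_mono) auto
  finally have u: "ln (real N) \<le> 4 * real k" using k(1) by simp
  \<comment> \<open>This yields \<open>1/2 \<le> ln 2\<close>, so that \<open>k\<close> is at most
    \<open>2 * k * ln 2\<close>.\<close>
  have "exp 1 \<le> (2::real) ^ 2" using exp_le by simp
  then have "1 \<le> ln ((2::real) ^ 2)" by (subst ln_ge_iff) auto
  then have "1 \<le> 2 * ln (2::real)" by (simp only: ln_realpow)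
  then have "real k * 1 \<le> real k * (2 * ln 2)" by (intro mult_left_mono) auto
  then have "real k \<le> real (2 * k) * ln 2" by simp
  also have "\<dots> = ln (2 ^ (2 * k))" by (rule ln_realpow[symmetric])
  also have "\<dots> \<le> ln (real N)"
  proof -
    have "real (2 ^ (2 * k)) \<le> real N" using N(1) by (simp only: of_nat_le_iff)
    then show ?thesis using assms by simp
  qed
  finally have l: "real k \<le> ln (real N)" .
  have "2 ^ k * 2 ^ k \<le> N" using N(1) by (simp add: mult_2 power_add)
  moreover have "2 * 2 ^ k < N" using N(2) by simp
  ultimately show thesis using that u l by blast
qed

theorem theorem38:
  fixes U :: "nat \<Rightarrow> wival set"
    and D :: "nat \<Rightarrow> cell_probe_ds"
    and w :: "nat \<Rightarrow> nat"
    and tu tq :: "nat \<Rightarrow> real"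
  assumes inputs: "\<And>N. grid_wivals N \<subseteq> U N \<and> U N \<subseteq> wivals N"
    and cells: "\<And>N. word_size (w N) (D N)"
    and cell_bits: "(\<lambda>N. real (w N)) \<in> O(\<lambda>N. ln (real N))"
    and correct: "\<And>N. solves_dynamic_mwis (U N) (D N)"
    and time: "\<And>N. amortized_time (U N) (D N) (tu N) (tq N)"
  shows "(\<lambda>N. max (tu N) (tq N)) \<in> \<Omega>(\<lambda>N. ln (real N) / ln (ln (real N)))"
proof -
  obtain C where C: "C > 0" "\<forall>\<^sub>F N in sequentially. norm (real (w N)) \<le> C * norm (ln (real N))"
    using cell_bits by (auto elim!: landau_o.bigE)
  have ln_ln: "\<forall>\<^sub>F N in sequentially. 1 \<le> ln (ln (real N))"
    using filterlim_compose[OF ln_at_top filterlim_compose[OF ln_at_top filterlim_real_sequentially]]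
    by (auto simp: filterlim_at_top)
  show ?thesis
  proof (rule landau_omega.bigI)
    \<comment> \<open>128 is 16 from \<open>(?L / 4)\<^sup>2\<close> times 8 from
      \<open>time_ge\<close>; \<open>1 + C\<close> bounds \<open>k + w N\<close> in units of
      \<open>?L\<close>.\<close>
    show "0 < 1 / (128 * (1 + C))" using C(1) by simp
    show "\<forall>\<^sub>F N in sequentially. 1 / (128 * (1 + C)) * norm (ln (real N) / ln (ln (real N)))
        \<le> norm (max (tu N) (tq N))"
      using C(2) ln_ln eventually_ge_at_top[of 16]
    proof eventually_elim
      case (elim N)
      let ?L = "ln (real N)" and ?M = "max (tu N) (tq N)"
      obtain k where k: "2 * 2 ^ k < N" "2 ^ k * 2 ^ k \<le> N" "?L \<le> 4 * real k" "real k \<le> ?L"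
        using exists_exponent[OF elim(3)] .
      interpret mwis_structure N k "w N" "U N" "D N"
        by unfold_locales (use k inputs cells correct in auto)
      have L: "0 < ?L" using elim(3) by simp
      moreover have "0 < ln ?L" using elim(2) by linarith
      ultimately have "1 < ?L" by simp
      have "(?L / 4)\<^sup>2 \<le> (real k)\<^sup>2" using k(3) L by (intro power_mono) auto
      also have "\<dots> \<le> 8 * (real k + real (w N)) * ?M" by (rule time_ge[OF time])
      finally have le: "(?L / 4)\<^sup>2 \<le> 8 * (real k + real (w N)) * ?M" .
      moreover have "0 < (?L / 4)\<^sup>2" using L by simp
      ultimately have "0 < 8 * (real k + real (w N)) * ?M" by linarith
      \<comment> \<open>The time bounds are arbitrary reals; positivity is needed to enlarge the
        factor in front of \<open>?M\<close> and to remove the norm.\<close>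
      then have M: "0 < ?M" by (simp add: zero_less_mult_iff)
      have "real k + real (w N) \<le> (1 + C) * ?L"
        using elim(1) k(4) L by (simp add: algebra_simps)
      then have "8 * (real k + real (w N)) * ?M \<le> 8 * ((1 + C) * ?L) * ?M"
        using M by (intro mult_right_mono mult_left_mono) auto
      with le have "?L * ?L \<le> ?L * (128 * (1 + C) * ?M)"
        by (simp add: power2_eq_square algebra_simps)
      then have "?L \<le> 128 * (1 + C) * ?M" using L by (simp only: mult_le_cancel_left_pos)
      then have "1 / (128 * (1 + C)) * ?L \<le> ?M" using C(1) by (simp add: field_simps)
      \<comment> \<open>The bound \<open>?L\<close> is already reached; dividing by
        \<open>ln ?L\<close>, which is at least 1, only weakens it.\<close>
      moreover have "?L / ln ?L \<le> ?L / 1" using elim(2) \<open>1 < ?L\<close> by (intro divide_left_mono) auto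
      then have "1 / (128 * (1 + C)) * (?L / ln ?L) \<le> 1 / (128 * (1 + C)) * ?L"
        using C(1) by (intro mult_left_mono) auto
      ultimately show ?case using L M elim(2) by simp
    qed
  qed
qed

end
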